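(* Let $q\ge 3$ be a prime power and let $m,r$ be integers with $1\le r\le m$. Then $$e_r(q,m)=q^m+p_{m-r-1}.$$
   Context: $\mathbb{F}_q$ is the finite field with $q$ elements. $S=\mathbb{F}_q[X_0,X_1,\dots,X_m]$ and $S_d$ is the $\mathbb{F}_q$-vector space of homogeneous polynomials in $S$ of degree $d$, together with $0$. For homogeneous $F_1,\dots,F_r\in S$, $\mathsf{V}(F_1,\dots,F_r)$ denotes the set of their common zeros in $\mathbb{P}^m(\mathbb{F}_q)$ (only $\mathbb{F}_q$-rational points). For $1\le r\le\binom{m+d}{d}$, $$e_r(d,m):=\max\{|\mathsf{V}(F_1,\dots,F_r)| : F_1,\dots,F_r\in S_d \text{ linearly independent over } \mathbb{F}_q\};$$ here it is used with $d=q$. For $k\ge 0$, $p_k:=q^k+q^{k-1}+\dots+q+1$, and $p_k:=0$ for $k<0$. *)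

theory Defs
  imports Complex_Main "HOL-Library.Poly_Mapping" "HOL-Library.Cardinality"
begin

section \<open>Homogeneous polynomials in $X_0, \dots, X_m$\<close>

text \<open>
  Polynomials are finitely supported maps from monomials (finitely supported exponent vectors
  indexed by the variable number) to coefficients; the ring structure is the convolution product
  of \<^theory>\<open>HOL-Library.Poly_Mapping\<close>.
\<close>

type_synonym 'a mpoly = "(nat \<Rightarrow>\<^sub>0 nat) \<Rightarrow>\<^sub>0 'a"

definition mono_degree :: "(nat \<Rightarrow>\<^sub>0 nat) \<Rightarrow> nat" where
  "mono_degree \<mu> = (\<Sum>i\<in>Poly_Mapping.keys \<mu>. Poly_Mapping.lookup \<mu> i)"

text \<open>The zero polynomial has no monomials and therefore belongs to every space below.\<close>

definition homogeneous_polys :: "nat \<Rightarrow> nat \<Rightarrow> 'a::field mpoly set" where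
  "homogeneous_polys m d =
     {F. \<forall>\<mu>\<in>Poly_Mapping.keys F. Poly_Mapping.keys \<mu> \<subseteq> {..m} \<and> mono_degree \<mu> = d}"

definition eval_mpoly :: "(nat \<Rightarrow> 'a::field) \<Rightarrow> 'a mpoly \<Rightarrow> 'a" where
  "eval_mpoly x F =
     (\<Sum>\<mu>\<in>Poly_Mapping.keys F.
        Poly_Mapping.lookup F \<mu> *
        (\<Prod>i\<in>Poly_Mapping.keys \<mu>. x i ^ Poly_Mapping.lookup \<mu> i))"

definition scale_mpoly :: "'a::field \<Rightarrow> 'a mpoly \<Rightarrow> 'a mpoly" where
  "scale_mpoly c F = Poly_Mapping.map ((*) c) F"

global_interpretation mpoly: vector_space scale_mpoly
  by unfold_locales
    (simp_all add: scale_mpoly_def mult_map_scale_conv_mult distrib_left distrib_right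
      single_add mult_single mult.assoc [symmetric])


section \<open>Projective space and projective zero sets\<close>

text \<open>A vector $(x_0, \dots, x_m)$ is encoded as a function that vanishes beyond $m$.\<close>

definition nonzero_vectors :: "nat \<Rightarrow> (nat \<Rightarrow> 'a::field) set" where
  "nonzero_vectors m = {x. (\<forall>i>m. x i = 0) \<and> (\<exists>i\<le>m. x i \<noteq> 0)}"

definition proportional :: "nat \<Rightarrow> ((nat \<Rightarrow> 'a::field) \<times> (nat \<Rightarrow> 'a)) set" where
  "proportional m =
     {(x, y) \<in> nonzero_vectors m \<times> nonzero_vectors m. \<exists>c. c \<noteq> 0 \<and> y = (\<lambda>i. c * x i)}"

definition proj_space :: "nat \<Rightarrow> (nat \<Rightarrow> 'a::field) set set" where
  "proj_space m = nonzero_vectors m // proportional m"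

lemma equiv_proportional:
  "equiv (nonzero_vectors m :: (nat \<Rightarrow> 'a::field) set) (proportional m)"
proof (rule equivI)
  show "proportional m \<subseteq> (nonzero_vectors m :: (nat \<Rightarrow> 'a) set) \<times> nonzero_vectors m"
    by (auto simp: proportional_def)
  show "refl_on (nonzero_vectors m :: (nat \<Rightarrow> 'a) set) (proportional m)"
    by (auto simp: refl_on_def proportional_def intro!: exI [of _ 1])
  show "sym (proportional m :: ((nat \<Rightarrow> 'a) \<times> _) set)"
  proof (rule symI)
    fix x y :: "nat \<Rightarrow> 'a"
    assume "(x, y) \<in> proportional m"
    then obtain c where "x \<in> nonzero_vectors m" "y \<in> nonzero_vectors m" "c \<noteq> 0"
      "y = (\<lambda>i. c * x i)"
      by (auto simp: proportional_def)
    moreover from this have "x = (\<lambda>i. inverse c * y i)"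
      by (simp add: mult.assoc [symmetric])
    ultimately show "(y, x) \<in> proportional m"
      unfolding proportional_def using nonzero_imp_inverse_nonzero by blast
  qed
  show "trans (proportional m :: ((nat \<Rightarrow> 'a) \<times> _) set)"
  proof (rule transI)
    fix x y z :: "nat \<Rightarrow> 'a"
    assume "(x, y) \<in> proportional m" "(y, z) \<in> proportional m"
    then obtain c d where "x \<in> nonzero_vectors m" "z \<in> nonzero_vectors m" "c \<noteq> 0" "d \<noteq> 0"
      "y = (\<lambda>i. c * x i)" "z = (\<lambda>i. d * y i)"
      by (auto simp: proportional_def)
    moreover from this have "z = (\<lambda>i. (d * c) * x i)" "d * c \<noteq> 0"
      by (simp_all add: mult.assoc)
    ultimately show "(x, z) \<in> proportional m"
      unfolding proportional_def by blast
  qed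
qed

definition proj_zeros :: "nat \<Rightarrow> 'a::field mpoly set \<Rightarrow> (nat \<Rightarrow> 'a) set set" where
  "proj_zeros m \<F> = {P \<in> proj_space m. \<forall>x\<in>P. \<forall>F\<in>\<F>. eval_mpoly x F = 0}"

text \<open>
  For homogeneous polynomials vanishing at a projective point does not depend on the
  representative, so that the quantifier over \<open>x\<in>P\<close> above may be read existentially as well.
\<close>

lemma eval_mpoly_scaled:
  assumes "F \<in> homogeneous_polys m d"
  shows "eval_mpoly (\<lambda>i. c * x i) F = c ^ d * eval_mpoly x F"
proof -
  have "Poly_Mapping.lookup F \<mu> *
          (\<Prod>i\<in>Poly_Mapping.keys \<mu>. (c * x i) ^ Poly_Mapping.lookup \<mu> i) =
        c ^ d * (Poly_Mapping.lookup F \<mu> *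
          (\<Prod>i\<in>Poly_Mapping.keys \<mu>. x i ^ Poly_Mapping.lookup \<mu> i))"
    if "\<mu> \<in> Poly_Mapping.keys F" for \<mu>
    using that assms
    by (auto simp: homogeneous_polys_def mono_degree_def power_mult_distrib prod.distrib
        power_sum [symmetric])
  then show ?thesis
    unfolding eval_mpoly_def sum_distrib_left by (intro sum.cong refl)
qed

lemma finite_nonzero_vectors:
  "finite (nonzero_vectors m :: (nat \<Rightarrow> 'a::{field,finite}) set)"
proof (rule finite_subset)
  show "nonzero_vectors m \<subseteq>
      {x :: nat \<Rightarrow> 'a. \<forall>i. (i \<in> {..m} \<longrightarrow> x i \<in> UNIV) \<and> (i \<notin> {..m} \<longrightarrow> x i = 0)}"
    by (auto simp: nonzero_vectors_def)
qed (rule finite_set_of_finite_funs; simp)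

lemma finite_proj_space: "finite (proj_space m :: (nat \<Rightarrow> 'a::{field,finite}) set set)"
  unfolding proj_space_def
  by (rule finite_quotient) (auto simp: finite_nonzero_vectors proportional_def)


section \<open>The maximal number of common zeros\<close>

text \<open>
  A linearly independent family $F_1, \dots, F_r$ is given by its set of members, which has
  exactly \<open>r\<close> elements.
\<close>

definition zero_counts :: "'a::{field,finite} itself \<Rightarrow> nat \<Rightarrow> nat \<Rightarrow> nat \<Rightarrow> nat set" where
  "zero_counts T r d m =
     {card (proj_zeros m \<F>) | \<F> :: 'a mpoly set.
        finite \<F> \<and> card \<F> = r \<and> \<F> \<subseteq> homogeneous_polys m d \<and> mpoly.independent \<F>}"

text \<open>As \<^term>\<open>zero_counts T r d m\<close> is finite, this is a maximum whenever that set is nonempty,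
  that is, whenever \<open>r \<le> (m + d) choose d\<close>.\<close>

definition max_zeros :: "'a::{field,finite} itself \<Rightarrow> nat \<Rightarrow> nat \<Rightarrow> nat \<Rightarrow> nat" where
  "max_zeros T r d m = Max (zero_counts T r d m)"

lemma finite_zero_counts: "finite (zero_counts T r d m)"
proof (rule finite_subset)
  show "zero_counts T r d m \<subseteq> {..card (proj_space m :: (nat \<Rightarrow> 'a) set set)}"
    by (auto simp: zero_counts_def proj_zeros_def intro!: card_mono finite_proj_space)
qed simp

definition proj_count :: "nat \<Rightarrow> int \<Rightarrow> nat" where
  "proj_count q k = (if k < 0 then 0 else (\<Sum>i\<le>nat k. q ^ i))"

end

theory Submission
  imports Defs "HOL-Computational_Algebra.Polynomial"
begin

text \<open>
  The only geometric input is the case \<open>r = 1\<close>: a nonzero form of degree \<open>q\<close> is nonzero at no fewer than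
  $(q-1)q^{m-1}$ vectors of $\mathbb{F}_q^{m+1}$. Replacing $x_i^q$ by $x_i$ turns it into a nonzero
  reduced polynomial, and a reduced polynomial has at least $\prod_i (q - a_i)$ nonzeros, where
  $x^a$ is its lexicographically leading monomial.

  The bound for \<open>r\<close> forms then follows by averaging over their span, as in the Griesmer bound for
  generalized Hamming weights: a vector that is not a common zero is a nonzero of $(q-1)q^{r-1}$
  elements of the span, and each of its $q^r - 1$ nonzero elements has at least $(q-1)q^{m-1}$
  nonzeros. So at least $q^m - q^{m-r}$ vectors are not common zeros.
  Equality holds for the forms $X_i^q - X_i X_0^{q-1}$ with $1 \le i \le r$.
\<close>

section \<open>Vectors supported on a finite index set\<close>

text \<open>One encoding serves two spaces: vectors of F_q^{m+1} are supported on
  \<open>{..m}\<close>, and coefficient families of linear combinations are supported on the set of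
  forms.\<close>

definition supported_on :: "'b set \<Rightarrow> ('b \<Rightarrow> 'a::zero) set" where
  "supported_on S = {x. \<forall>i. i \<notin> S \<longrightarrow> x i = 0}"

lemma supported_on_empty: "supported_on {} = {\<lambda>_. 0}"
  by (auto simp: supported_on_def)

lemma bij_betw_fun_upd_supported_on:
  assumes "j \<notin> S"
  shows "bij_betw (\<lambda>(x, t). x(j := t)) (supported_on S \<times> UNIV) (supported_on (insert j S))"
proof (rule bij_betw_byWitness [where f' = "\<lambda>x. (x(j := 0), x j)"])
qed (use assms in \<open>auto simp: supported_on_def fun_eq_iff split: if_splits\<close>)

lemma finite_supported_on [simp]:
  assumes "finite S"
  shows "finite (supported_on S :: ('b \<Rightarrow> 'a::{zero,finite}) set)"
  using assms
proof induction
  case (insert j S)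
  have "bij_betw (\<lambda>(x, t). x(j := t)) (supported_on S \<times> UNIV)
      (supported_on (insert j S) :: ('b \<Rightarrow> 'a) set)"
    by (rule bij_betw_fun_upd_supported_on) fact
  from bij_betw_finite [OF this] show ?case
    using insert.IH by simp
qed (simp add: supported_on_empty)

lemma card_supported_on:
  assumes "finite S"
  shows "card (supported_on S :: ('b \<Rightarrow> 'a::{zero,finite}) set) = CARD('a) ^ card S"
  using assms
proof induction
  case (insert j S)
  have "bij_betw (\<lambda>(x, t). x(j := t)) (supported_on S \<times> UNIV)
      (supported_on (insert j S) :: ('b \<Rightarrow> 'a) set)"
    by (rule bij_betw_fun_upd_supported_on) fact
  from bij_betw_same_card [OF this] show ?case
    using insert by (simp add: card_cartesian_product mult.commute)
qed (simp add: supported_on_empty)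

section \<open>Nonzeros of a polynomial with separated monomials\<close>

lemma card_nonroots_ge:
  fixes p :: "'a::{field,finite} poly"
  assumes "p \<noteq> 0" "degree p \<le> e"
  shows "CARD('a) - e \<le> card {t. poly p t \<noteq> 0}"
proof -
  have "{t. poly p t \<noteq> 0} = UNIV - {t. poly p t = 0}"
    by auto
  then have "card {t. poly p t \<noteq> 0} = CARD('a) - card {t. poly p t = 0}"
    by (simp add: card_Diff_subset)
  then show ?thesis
    using card_poly_roots_bound [OF assms(1)] assms(2) by linarith
qed

text \<open>The witness is the lexicographically leading monomial.\<close>

lemma footprint_bound:
  fixes c :: "'k \<Rightarrow> 'a::{field,finite}" and a :: "'k \<Rightarrow> 'i \<Rightarrow> nat"
  assumes "finite S" "finite K" "K \<noteq> {}" "\<And>k. k \<in> K \<Longrightarrow> c k \<noteq> 0"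
    and "\<And>k l. k \<in> K \<Longrightarrow> l \<in> K \<Longrightarrow> (\<And>i. i \<in> S \<Longrightarrow> a k i = a l i) \<Longrightarrow> k = l"
  shows "\<exists>k\<in>K. (\<Prod>i\<in>S. CARD('a) - a k i)
           \<le> card {x \<in> supported_on S. (\<Sum>k\<in>K. c k * (\<Prod>i\<in>S. x i ^ a k i)) \<noteq> 0}"
  using assms
proof (induction arbitrary: K)
  case empty
  \<comment> \<open>Without variables any two exponent vectors agree, so \<open>K\<close> is a
    singleton and the sum is the nonzero constant \<open>c k\<close>.\<close>
  then obtain k where "k \<in> K"
    by blast
  with empty.prems have "K = {k}"
    by blast
  with empty.prems(3) [of k] show ?case
    by (simp add: supported_on_empty)
next
  case (insert j S)
  \<comment> \<open>For fixed coordinates \<open>x\<close> on \<open>S\<close> the sum is a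
    polynomial \<open>p x\<close> in the coordinate \<open>j\<close>, of degree at most
    \<open>e\<close>, whose coefficient at \<open>e\<close> comes from the terms in
    \<open>L\<close>. The induction hypothesis for \<open>L\<close> bounds the set \<open>Z\<close>
    where this coefficient is nonzero, and each \<open>x\<close> in \<open>Z\<close> has at least q
    - e good values of \<open>t\<close>.\<close>
  define e where "e = Max ((\<lambda>k. a k j) ` K)"
  define L where "L = {k \<in> K. a k j = e}"
  define T where "T x k = c k * (\<Prod>i\<in>S. x i ^ a k i)" for x k
  define Z where "Z = {x \<in> supported_on S. sum (T x) L \<noteq> 0}"
  define p where "p x = (\<Sum>k\<in>K. monom (T x k) (a k j))" for x
  have e_max: "a k j \<le> e" if "k \<in> K" for k
    using that insert.prems by (simp add: e_def)
  have "e \<in> (\<lambda>k. a k j) ` K"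
    unfolding e_def using insert.prems by (intro Max_in) auto
  then have "L \<noteq> {}"
    by (auto simp: L_def)
  \<comment> \<open>On \<open>L\<close> the exponents of \<open>j\<close> all equal
    \<open>e\<close>, so the exponents on \<open>S\<close> alone still separate the terms.\<close>
  moreover have "k = l" if "k \<in> L" "l \<in> L" "\<And>i. i \<in> S \<Longrightarrow> a k i = a l i" for k l
    using that by (intro insert.prems(4)) (auto simp: L_def)
  ultimately obtain k where k: "k \<in> L" "(\<Prod>i\<in>S. CARD('a) - a k i) \<le> card Z"
    using insert.IH [of L] insert.prems by (auto simp: L_def Z_def T_def)
  have "coeff (p x) e = sum (T x) L" for x
    using insert.prems(1)
    by (simp add: p_def coeff_sum coeff_monom L_def sum.inter_filter)
  then have p_nz: "p x \<noteq> 0" if "x \<in> Z" for x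
    using that by (auto simp: Z_def dest: arg_cong [where f = "\<lambda>p. coeff p e"])
  have p_deg: "degree (p x) \<le> e" for x
    unfolding p_def
    by (intro degree_sum_le insert.prems(1)) (meson degree_monom_le e_max le_trans)
  have p_eval: "(\<Sum>k\<in>K. c k * (\<Prod>i\<in>insert j S. (x(j := t)) i ^ a k i)) = poly (p x) t" for x t
  proof -
    have "(\<Prod>i\<in>S. (x(j := t)) i ^ a k i) = (\<Prod>i\<in>S. x i ^ a k i)" for k
      using insert.hyps by (intro prod.cong) auto
    then show ?thesis
      using insert.hyps by (simp add: p_def T_def poly_sum poly_monom mult_ac)
  qed
  let ?N = "{x \<in> supported_on (insert j S). (\<Sum>k\<in>K. c k * (\<Prod>i\<in>insert j S. x i ^ a k i)) \<noteq> 0}"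
  have fin: "finite Z"
    using insert.hyps by (simp add: Z_def)
  have "(\<Prod>i\<in>insert j S. CARD('a) - a k i) \<le> card Z * (CARD('a) - e)"
    using k insert.hyps by (simp add: L_def mult.commute)
  also have "\<dots> \<le> (\<Sum>x\<in>Z. card {t. poly (p x) t \<noteq> 0})"
    using sum_mono [of Z "\<lambda>_. CARD('a) - e", OF card_nonroots_ge [OF p_nz p_deg]] by simp
  also have "\<dots> = card (SIGMA x:Z. {t. poly (p x) t \<noteq> 0})"
    using fin by simp
  also have "\<dots> \<le> card ?N"
  proof (rule card_inj_on_le)
    have bij: "bij_betw (\<lambda>(x, t). x(j := t)) (supported_on S \<times> UNIV)
        (supported_on (insert j S) :: ('i \<Rightarrow> 'a) set)"
      by (rule bij_betw_fun_upd_supported_on) fact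
    show "inj_on (\<lambda>(x, t). x(j := t)) (SIGMA x:Z. {t. poly (p x) t \<noteq> 0})"
      using bij by (rule inj_on_subset [OF bij_betw_imp_inj_on]) (auto simp: Z_def)
    show "(\<lambda>(x, t). x(j := t)) ` (SIGMA x:Z. {t. poly (p x) t \<noteq> 0}) \<subseteq> ?N"
      using bij_betwE [OF bij] by (auto simp: Z_def p_eval simp del: fun_upd_apply)
  qed (use insert.hyps in simp)
  finally show ?case
    using k(1) by (auto simp: L_def)
qed

section \<open>The least value of the footprint product\<close>

text \<open>Merging two exponents can only lower the product, since (q - u)(q - s) = (q - u - s) q +
  u s. The factor \<open>q\<close> on the right avoids the exponent \<open>card S - 1\<close>, so
  that the induction can start at the empty set.\<close>

lemma prod_diff_ge:
  fixes a :: "'i \<Rightarrow> nat"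
  assumes "finite S" "sum a S \<le> q"
  shows "(q - sum a S) * q ^ card S \<le> q * (\<Prod>i\<in>S. q - a i)"
  using assms
proof induction
  case (insert j S)
  define s where "s = sum a S"
  have le: "a j + s \<le> q"
    using insert by (simp add: s_def)
  have "(q - (a j + s)) * q \<le> (q - a j) * (q - s)"
  proof -
    have "int (q - (a j + s)) * int q + int (a j) * int s = int (q - a j) * int (q - s)"
      using le by (simp add: of_nat_diff algebra_simps)
    then have "(q - (a j + s)) * q + a j * s = (q - a j) * (q - s)"
      by (simp flip: of_nat_mult of_nat_add)
    then show ?thesis
      by linarith
  qed
  then have "(q - (a j + s)) * q * q ^ card S \<le> (q - a j) * ((q - s) * q ^ card S)"
    by (metis mult.assoc mult_le_mono1)
  also have "\<dots> \<le> (q - a j) * (q * (\<Prod>i\<in>S. q - a i))"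
    using insert le by (intro mult_le_mono2) (simp add: s_def)
  finally show ?case
    using insert.hyps by (simp add: s_def mult_ac)
qed simp

text \<open>The extremal exponents are q - 1, 1, 0, ..., 0. If a_j is positive, the other exponents
  sum to at most q - a_j, so their m factors contribute at least a_j q^{m-1}; and (q - a_j) a_j
  \<ge> q - 1 because 1 \<le> a_j < q.\<close>

lemma prod_diff_ge_reduced:
  fixes a :: "'i \<Rightarrow> nat"
  assumes "finite S" "card S = Suc m" "m \<ge> 1" "sum a S \<le> q" "\<And>i. i \<in> S \<Longrightarrow> a i < q" "q > 0"
  shows "(q - 1) * q ^ (m - 1) \<le> (\<Prod>i\<in>S. q - a i)"
proof (cases "\<forall>i\<in>S. a i = 0")
  case True
  then have "(\<Prod>i\<in>S. q - a i) = q * (q * q ^ (m - 1))"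
    using assms by (simp flip: power_Suc)
  moreover have "(q - 1) * q ^ (m - 1) \<le> q * (q * q ^ (m - 1))"
    using assms by (intro mult_le_mono) auto
  ultimately show ?thesis
    by simp
next
  case False
  then obtain j where j: "j \<in> S" "a j \<ge> 1"
    by (auto simp: Suc_le_eq)
  define s where "s = sum a (S - {j})"
  have s: "a j + s \<le> q"
    using assms j by (simp add: s_def sum.remove)
  have card: "card (S - {j}) = m"
    using assms j by simp
  have "a j * q ^ m \<le> (q - s) * q ^ m"
    using s by (intro mult_le_mono1) linarith
  also have "\<dots> \<le> q * (\<Prod>i\<in>S - {j}. q - a i)"
    using prod_diff_ge [of "S - {j}" a q] assms s card by (simp add: s_def)
  finally have "q * (a j * q ^ (m - 1)) \<le> q * (\<Prod>i\<in>S - {j}. q - a i)"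
    using assms(3) by (cases m) (simp_all add: mult_ac)
  then have rest: "a j * q ^ (m - 1) \<le> (\<Prod>i\<in>S - {j}. q - a i)"
    using assms(6) by simp
  \<comment> \<open>With a_j = u + 1 and q - a_j = v + 1 the inequality below reads u + v + 1 \<le>
    (v + 1)(u + 1).\<close>
  obtain u v where uv: "a j = Suc u" "q = Suc (a j) + v"
    using j assms(5) [of j] by (metis Suc_le_D One_nat_def less_iff_Suc_add add_Suc)
  have "q - 1 \<le> (q - a j) * a j"
    by (simp add: uv)
  then have "(q - 1) * q ^ (m - 1) \<le> (q - a j) * (a j * q ^ (m - 1))"
    by (metis mult.assoc mult_le_mono1)
  also have "\<dots> \<le> (q - a j) * (\<Prod>i\<in>S - {j}. q - a i)"
    using rest by simp
  also have "\<dots> = (\<Prod>i\<in>S. q - a i)"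
    using j assms by (simp add: prod.remove)
  finally show ?thesis .
qed

section \<open>The identity x^q = x\<close>

text \<open>Multiplication by \<open>x\<close> permutes the nonzero elements, so their product is
  unchanged when multiplied by x^{q-1}.\<close>

lemma power_card_eq_1:
  fixes x :: "'a::{field,finite}"
  assumes "x \<noteq> 0"
  shows "x ^ (CARD('a) - 1) = 1"
proof -
  have "bij_betw ((*) x) (- {0}) (- {0})"
    by (rule bij_betw_byWitness [where f' = "\<lambda>y. y / x"]) (use assms in auto)
  then have "prod id (- {0}) = (\<Prod>y\<in>- {0}. id (x * y))"
    using prod.reindex_bij_betw [of "(*) x" "- {0}" "- {0}" id] by simp
  also have "\<dots> = x ^ (CARD('a) - 1) * prod id (- {0})"
    by (simp add: prod.distrib Compl_eq_Diff_UNIV card_Diff_singleton)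
  finally show ?thesis
    by simp
qed

lemma power_card_eq: "x ^ CARD('a) = x" for x :: "'a::{field,finite}"
proof (cases "x = 0")
  case False
  have "x ^ CARD('a) = x * x ^ (CARD('a) - 1)"
    by (metis power_eq_if zero_less_card_finite less_numeral_extra(3))
  then show ?thesis
    by (simp only: power_card_eq_1 [OF False] mult_1_right)
qed simp

section \<open>Evaluation of linear combinations\<close>

text \<open>Lets several polynomials be evaluated over one common set of monomials.\<close>

lemma eval_mpoly_superset:
  assumes "finite A" "Poly_Mapping.keys F \<subseteq> A"
  shows "eval_mpoly x F = (\<Sum>\<mu>\<in>A. Poly_Mapping.lookup F \<mu> *
           (\<Prod>i\<in>Poly_Mapping.keys \<mu>. x i ^ Poly_Mapping.lookup \<mu> i))"
  unfolding eval_mpoly_def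
  by (rule sum.mono_neutral_left) (use assms in \<open>auto simp: in_keys_iff\<close>)

lemma lookup_scale_mpoly:
  "Poly_Mapping.lookup (scale_mpoly c F) \<mu> = c * Poly_Mapping.lookup F \<mu>"
  by (simp add: scale_mpoly_def Poly_Mapping.map.rep_eq when_def)

lemma keys_sum_scale_mpoly:
  "Poly_Mapping.keys (\<Sum>F\<in>\<F>. scale_mpoly (c F) F) \<subseteq> (\<Union>F\<in>\<F>. Poly_Mapping.keys F)"
proof
  fix \<mu>
  assume "\<mu> \<in> Poly_Mapping.keys (\<Sum>F\<in>\<F>. scale_mpoly (c F) F)"
  then have "(\<Sum>F\<in>\<F>. c F * Poly_Mapping.lookup F \<mu>) \<noteq> 0"
    by (simp add: in_keys_iff lookup_sum lookup_scale_mpoly)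
  then obtain F where "F \<in> \<F>" "c F * Poly_Mapping.lookup F \<mu> \<noteq> 0"
    by (meson sum.neutral)
  then show "\<mu> \<in> (\<Union>F\<in>\<F>. Poly_Mapping.keys F)"
    by (auto simp: in_keys_iff)
qed

lemma eval_mpoly_sum_scale:
  assumes "finite \<F>"
  shows "eval_mpoly x (\<Sum>F\<in>\<F>. scale_mpoly (c F) F) = (\<Sum>F\<in>\<F>. c F * eval_mpoly x F)"
proof -
  define A where "A = (\<Union>F\<in>\<F>. Poly_Mapping.keys F)"
  define M where "M \<mu> = (\<Prod>i\<in>Poly_Mapping.keys \<mu>. x i ^ Poly_Mapping.lookup \<mu> i)" for \<mu>
  have A: "finite A"
    using assms by (simp add: A_def)
  have "eval_mpoly x (\<Sum>F\<in>\<F>. scale_mpoly (c F) F) =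
      (\<Sum>\<mu>\<in>A. (\<Sum>F\<in>\<F>. c F * Poly_Mapping.lookup F \<mu>) * M \<mu>)"
    unfolding M_def
    by (subst eval_mpoly_superset [OF A])
      (auto simp: A_def lookup_sum lookup_scale_mpoly dest: subsetD [OF keys_sum_scale_mpoly])
  also have "\<dots> = (\<Sum>F\<in>\<F>. c F * (\<Sum>\<mu>\<in>A. Poly_Mapping.lookup F \<mu> * M \<mu>))"
    unfolding sum_distrib_right sum_distrib_left by (subst sum.swap) (simp add: mult.assoc)
  also have "\<dots> = (\<Sum>F\<in>\<F>. c F * eval_mpoly x F)"
    unfolding M_def
    by (intro sum.cong refl arg_cong2 [where f = "(*)"] eval_mpoly_superset [symmetric] A)
      (auto simp: A_def)
  finally show ?thesis .
qed

lemma homogeneous_polys_sum_scale: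
  assumes "\<F> \<subseteq> homogeneous_polys m d"
  shows "(\<Sum>F\<in>\<F>. scale_mpoly (c F) F) \<in> homogeneous_polys m d"
  using assms keys_sum_scale_mpoly [of c \<F>] unfolding homogeneous_polys_def by blast

section \<open>Nonzeros of a single form of degree q\<close>

lemma CARD_field_gt_1: "CARD('a::{field,finite}) > 1"
proof -
  have "card {0, 1 :: 'a} \<le> CARD('a)"
    by (rule card_mono) auto
  then show ?thesis
    by simp
qed

text \<open>Reducing \<open>x\<^sub>i ^ q\<close> to \<open>x\<^sub>i\<close> keeps the exponent vectors of degree \<open>q\<close> apart: those affected are the
  ones whose degree becomes \<open>1\<close>.\<close>

lemma reduced_exponent_inverse:
  fixes f :: "'i \<Rightarrow> nat"
  assumes "finite S" "sum f S = q" "q > 1" "i \<in> S"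
  defines "g \<equiv> \<lambda>i. if f i = q then 1 else f i"
  shows "f i = (if sum g S = q then g i else q * g i)"
proof (cases "\<exists>j\<in>S. f j = q")
  case True
  then obtain j where j: "j \<in> S" "f j = q"
    by blast
  then have "sum f (S - {j}) = 0"
    using assms by (simp add: sum.remove)
  then have zero: "f k = 0" if "k \<in> S" "k \<noteq> j" for k
    using that assms(1) by simp
  have "sum g S = (\<Sum>k\<in>S. if k = j then 1 else 0)"
    by (rule sum.cong) (use zero j assms(3) in \<open>auto simp: g_def\<close>)
  \<comment> \<open>As 1 differs from \<open>q\<close>, the sum of \<open>g\<close> reveals that a
    q-th power was reduced; \<open>g\<close> is then the indicator of \<open>j\<close>, and
    \<open>f\<close> is q times it.\<close>
  then have "sum g S = 1"
    using assms(1) j by simp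
  then show ?thesis
    using assms(3,4) j zero [of i] by (cases "i = j") (auto simp: g_def)
next
  case False
  then have "sum g S = sum f S"
    by (intro sum.cong) (auto simp: g_def)
  then show ?thesis
    using False assms by auto
qed

lemma card_nonzeros_ge:
  fixes F :: "'a::{field,finite} mpoly"
  assumes "F \<in> homogeneous_polys m CARD('a)" "F \<noteq> 0" "m \<ge> 1"
  shows "(CARD('a) - 1) * CARD('a) ^ (m - 1)
           \<le> card {x \<in> supported_on {..m}. eval_mpoly x F \<noteq> 0}"
proof -
  define q where "q = CARD('a)"
  have q: "q > 1"
    using CARD_field_gt_1 [where 'a = 'a] by (simp add: q_def)
  define a where "a \<mu> i = (if Poly_Mapping.lookup \<mu> i = q then 1 else Poly_Mapping.lookup \<mu> i)"
    for \<mu> :: "nat \<Rightarrow>\<^sub>0 nat" and i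
  have keys: "Poly_Mapping.keys \<mu> \<subseteq> {..m}" if "\<mu> \<in> Poly_Mapping.keys F" for \<mu>
    using that assms by (auto simp: homogeneous_polys_def)
  have deg: "(\<Sum>i\<le>m. Poly_Mapping.lookup \<mu> i) = q" if "\<mu> \<in> Poly_Mapping.keys F" for \<mu>
  proof -
    have "(\<Sum>i\<le>m. Poly_Mapping.lookup \<mu> i) = mono_degree \<mu>"
      unfolding mono_degree_def
      by (rule sum.mono_neutral_right) (use keys [OF that] in \<open>auto simp: in_keys_iff\<close>)
    then show ?thesis
      using that assms by (auto simp: homogeneous_polys_def q_def)
  qed
  have eval: "eval_mpoly x F =
      (\<Sum>\<mu>\<in>Poly_Mapping.keys F. Poly_Mapping.lookup F \<mu> * (\<Prod>i\<le>m. x i ^ a \<mu> i))" for x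
  proof -
    have "(\<Prod>i\<in>Poly_Mapping.keys \<mu>. x i ^ Poly_Mapping.lookup \<mu> i) = (\<Prod>i\<le>m. x i ^ a \<mu> i)"
      if "\<mu> \<in> Poly_Mapping.keys F" for \<mu>
    proof (rule prod.mono_neutral_cong_left)
      show "\<forall>i\<in>{..m} - Poly_Mapping.keys \<mu>. x i ^ a \<mu> i = 1"
        using q by (auto simp: a_def in_keys_iff)
    qed (use keys [OF that] in \<open>auto simp: a_def q_def power_card_eq\<close>)
    then show ?thesis
      unfolding eval_mpoly_def by (intro sum.cong) auto
  qed
  have inverse: "Poly_Mapping.lookup \<mu> i = (if sum (a \<mu>) {..m} = q then a \<mu> i else q * a \<mu> i)"
    if "\<mu> \<in> Poly_Mapping.keys F" "i \<le> m" for \<mu> i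
    unfolding a_def [abs_def]
    by (rule reduced_exponent_inverse [OF _ deg [OF that(1)] q]) (use that(2) in simp_all)
  have inj: "\<mu> = \<nu>"
    if "\<mu> \<in> Poly_Mapping.keys F" "\<nu> \<in> Poly_Mapping.keys F" and eq: "\<And>i. i \<in> {..m} \<Longrightarrow> a \<mu> i = a \<nu> i"
    for \<mu> \<nu>
  proof (rule poly_mapping_eqI)
    fix i
    show "Poly_Mapping.lookup \<mu> i = Poly_Mapping.lookup \<nu> i"
    proof (cases "i \<le> m")
      case True
      \<comment> \<open>Equal sums select the same branch of \<open>inverse\<close> for both
        monomials.\<close>
      have "sum (a \<mu>) {..m} = sum (a \<nu>) {..m}"
        using eq by (intro sum.cong) auto
      then show ?thesis
        using inverse [OF that(1) True] inverse [OF that(2) True] eq [of i] True by simp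
    next
      case False
      then have "i \<notin> Poly_Mapping.keys \<mu>" "i \<notin> Poly_Mapping.keys \<nu>"
        using keys [OF that(1)] keys [OF that(2)] by auto
      then show ?thesis
        by (simp add: in_keys_iff)
    qed
  qed
  obtain \<mu> where \<mu>: "\<mu> \<in> Poly_Mapping.keys F"
    and le: "(\<Prod>i\<le>m. q - a \<mu> i) \<le> card {x \<in> supported_on {..m}. eval_mpoly x F \<noteq> 0}"
    using footprint_bound [of "{..m}" "Poly_Mapping.keys F" "Poly_Mapping.lookup F" a] assms(2) inj
    by (auto simp: eval q_def)
  have "a \<mu> i \<le> Poly_Mapping.lookup \<mu> i" for i
    using q by (simp add: a_def)
  then have "sum (a \<mu>) {..m} \<le> q"
    using sum_mono [of "{..m}" "a \<mu>" "Poly_Mapping.lookup \<mu>"] deg [OF \<mu>] by simp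
  \<comment> \<open>An exponent \<open>q\<close> has become 1, and every other exponent is at most
    the degree \<open>q\<close> but different from it.\<close>
  moreover have "a \<mu> i < q" if "i \<le> m" for i
    using that member_le_sum [of i "{..m}" "Poly_Mapping.lookup \<mu>"] deg [OF \<mu>] q by (auto simp: a_def)
  ultimately have "(q - 1) * q ^ (m - 1) \<le> (\<Prod>i\<le>m. q - a \<mu> i)"
    using assms(3) q by (intro prod_diff_ge_reduced) auto
  then show ?thesis
    using le by (simp add: q_def)
qed

section \<open>Averaging over the span of the forms\<close>

text \<open>The coordinates other than \<open>j\<close> may be chosen freely and the one at
  \<open>j\<close> then solves the equation, so the kernel has at least q^{|I|-1} elements.\<close>

lemma card_linear_form_nonzeros_le:
  fixes v :: "'b \<Rightarrow> 'a::{field,finite}"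
  assumes "finite I" "j \<in> I" "v j \<noteq> 0"
  shows "card {c \<in> supported_on I. (\<Sum>i\<in>I. c i * v i) \<noteq> 0} \<le> (CARD('a) - 1) * CARD('a) ^ (card I - 1)"
proof -
  let ?K = "{c \<in> supported_on I. (\<Sum>i\<in>I. c i * v i) = 0}"
  define h where "h c = c(j := - (\<Sum>i\<in>I - {j}. c i * v i) / v j)" for c
  have "card (supported_on (I - {j}) :: ('b \<Rightarrow> 'a) set) \<le> card ?K"
  proof (rule card_inj_on_le)
    show "inj_on h (supported_on (I - {j}))"
    proof (rule inj_on_inverseI)
      show "(h c)(j := 0) = c" if "c \<in> supported_on (I - {j})" for c
        using that by (auto simp: h_def supported_on_def)
    qed
    show "h ` supported_on (I - {j}) \<subseteq> ?K"
    proof (intro image_subsetI CollectI conjI)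
      fix c :: "'b \<Rightarrow> 'a"
      assume "c \<in> supported_on (I - {j})"
      then show "h c \<in> supported_on I"
        using assms(2) by (auto simp: supported_on_def h_def)
      have "(\<Sum>i\<in>I - {j}. h c i * v i) = (\<Sum>i\<in>I - {j}. c i * v i)"
        by (rule sum.cong) (auto simp: h_def)
      then show "(\<Sum>i\<in>I. h c i * v i) = 0"
        using assms by (simp add: sum.remove [of I j]) (simp add: h_def)
    qed
  qed (use assms in simp)
  then have K: "CARD('a) ^ (card I - 1) \<le> card ?K"
    using assms by (simp add: card_supported_on)
  have "{c \<in> supported_on I. (\<Sum>i\<in>I. c i * v i) \<noteq> 0} = supported_on I - ?K"
    by auto
  then have "card {c \<in> supported_on I. (\<Sum>i\<in>I. c i * v i) \<noteq> 0} = CARD('a) ^ card I - card ?K"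
    using assms by (simp add: card_Diff_subset card_supported_on)
  also have "\<dots> \<le> CARD('a) ^ card I - CARD('a) ^ (card I - 1)"
    using K by linarith
  also have "CARD('a) ^ card I = CARD('a) * CARD('a) ^ (card I - 1)"
    using assms by (metis card_gt_0_iff empty_iff power_eq_if less_numeral_extra(3))
  finally show ?thesis
    by (simp add: diff_mult_distrib)
qed

text \<open>Double counting of the pairs of a coefficient family \<open>c\<close> and a vector
  \<open>x\<close> at which the combination \<open>G c\<close> does not vanish.\<close>

lemma card_common_nonzeros_ge:
  fixes \<F> :: "'a::{field,finite} mpoly set"
  assumes "finite \<F>" "card \<F> = r" "1 \<le> r" "r \<le> m"
    and hom: "\<F> \<subseteq> homogeneous_polys m CARD('a)" and indep: "mpoly.independent \<F>"
  shows "CARD('a) ^ m - CARD('a) ^ (m - r)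
           \<le> card {x \<in> supported_on {..m}. \<exists>F\<in>\<F>. eval_mpoly x F \<noteq> 0}"
proof -
  define q where "q = CARD('a)"
  define V :: "(nat \<Rightarrow> 'a) set" where "V = supported_on {..m}"
  define C :: "('a mpoly \<Rightarrow> 'a) set" where "C = supported_on \<F>"
  define G where "G c x = (\<Sum>F\<in>\<F>. c F * eval_mpoly x F)" for c x
  define W where "W = {x \<in> V. \<exists>F\<in>\<F>. eval_mpoly x F \<noteq> 0}"
  have q: "q > 1"
    using CARD_field_gt_1 [where 'a = 'a] by (simp add: q_def)
  have fin: "finite V" "finite C" "finite W"
    using assms by (auto simp: V_def C_def W_def)
  have ge: "(q - 1) * q ^ (m - 1) \<le> card {x \<in> V. G c x \<noteq> 0}" if "c \<in> C - {\<lambda>_. 0}" for c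
  proof -
    from that obtain F where "c F \<noteq> 0"
      by (auto simp: fun_eq_iff)
    \<comment> \<open>Independence enters here: a nonzero coefficient family yields a nonzero form,
      to which the bound for a single form applies.\<close>
    with that have "(\<Sum>F\<in>\<F>. scale_mpoly (c F) F) \<noteq> 0"
      using mpoly.independentD [OF indep assms(1) subset_refl, of c F]
      by (auto simp: C_def supported_on_def)
    from card_nonzeros_ge [OF homogeneous_polys_sum_scale [OF hom] this] show ?thesis
      using assms by (simp add: q_def V_def G_def eval_mpoly_sum_scale)
  qed
  have zero: "(\<lambda>_. 0) \<in> C"
    by (simp add: C_def supported_on_def)
  have "(q ^ r - 1) * ((q - 1) * q ^ (m - 1)) = (\<Sum>c\<in>C - {\<lambda>_. 0}. (q - 1) * q ^ (m - 1))"
    using zero assms(1,2) by (simp add: C_def card_supported_on q_def)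
  also have "\<dots> \<le> (\<Sum>c\<in>C - {\<lambda>_. 0}. card {x \<in> V. G c x \<noteq> 0})"
    by (rule sum_mono) (rule ge)
  \<comment> \<open>The zero combination has no nonzeros, so readmitting it costs nothing.\<close>
  also have "\<dots> \<le> (\<Sum>c\<in>C. card {x \<in> V. G c x \<noteq> 0})"
    using fin by (intro sum_mono2) auto
  also have "\<dots> = (\<Sum>c\<in>C. \<Sum>x\<in>V. if G c x \<noteq> 0 then 1 else 0)"
    using fin by (simp add: sum.If_cases Int_def)
  also have "\<dots> = (\<Sum>x\<in>V. \<Sum>c\<in>C. if G c x \<noteq> 0 then 1 else 0)"
    by (rule sum.swap)
  also have "\<dots> = (\<Sum>x\<in>V. card {c \<in> C. G c x \<noteq> 0})"
    using fin by (simp add: sum.If_cases Int_def)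
  \<comment> \<open>At a common zero of the forms every combination vanishes, so only
    \<open>W\<close> contributes.\<close>
  also have "\<dots> = (\<Sum>x\<in>W. card {c \<in> C. G c x \<noteq> 0})"
    using fin by (intro sum.mono_neutral_right) (auto simp: W_def G_def)
  also have "\<dots> \<le> (\<Sum>x\<in>W. (q - 1) * q ^ (r - 1))"
  proof (rule sum_mono)
    fix x
    assume "x \<in> W"
    then obtain F where "F \<in> \<F>" "eval_mpoly x F \<noteq> 0"
      by (auto simp: W_def)
    then show "card {c \<in> C. G c x \<noteq> 0} \<le> (q - 1) * q ^ (r - 1)"
      using card_linear_form_nonzeros_le [of \<F> F "eval_mpoly x"] assms
      by (simp add: C_def G_def q_def)
  qed
  also have "\<dots> = card W * ((q - 1) * q ^ (r - 1))"
    by simp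
  \<comment> \<open>This splitting exposes the common factor (q - 1) q^{r-1}; cancelling it leaves
    (q^r - 1) q^{m-r} = q^m - q^{m-r}.\<close>
  also have "q ^ (m - 1) = q ^ (m - r) * q ^ (r - 1)"
    using assms by (simp flip: power_add)
  finally have "((q ^ r - 1) * q ^ (m - r)) * ((q - 1) * q ^ (r - 1)) \<le> card W * ((q - 1) * q ^ (r - 1))"
    by (simp only: mult_ac)
  then have "(q ^ r - 1) * q ^ (m - r) \<le> card W"
    using q by simp
  moreover have "q ^ m = q ^ r * q ^ (m - r)"
    using assms by (simp flip: power_add)
  ultimately show ?thesis
    by (simp add: diff_mult_distrib q_def W_def V_def)
qed

section \<open>From vectors to projective points\<close>

text \<open>Distinct nonzero scalars give distinct multiples, as a nonzero coordinate shows.\<close>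

lemma card_proportional_class:
  fixes x :: "nat \<Rightarrow> 'a::{field,finite}"
  assumes "x \<in> nonzero_vectors m"
  shows "card (proportional m `` {x}) = CARD('a) - 1"
proof -
  from assms obtain k where k: "x k \<noteq> 0"
    by (auto simp: nonzero_vectors_def)
  have "proportional m `` {x} = (\<lambda>c i. c * x i) ` (- {0})"
    using assms by (auto simp: proportional_def nonzero_vectors_def)
  moreover have "inj_on (\<lambda>c i. c * x i) (- {0})"
    by (rule inj_onI) (use k in \<open>auto dest: fun_cong [where x = k]\<close>)
  ultimately show ?thesis
    by (simp add: card_image Compl_eq_Diff_UNIV card_Diff_singleton)
qed

text \<open>By homogeneity a class consists of common zeros as soon as one representative is one, so
  the projective zeros partition the nonzero common zeros into classes of size q - 1.\<close>

lemma card_proj_zeros: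
  fixes \<F> :: "'a::{field,finite} mpoly set"
  assumes "\<F> \<subseteq> homogeneous_polys m d"
  shows "(CARD('a) - 1) * card (proj_zeros m \<F>) =
           card {x \<in> nonzero_vectors m. \<forall>F\<in>\<F>. eval_mpoly x F = 0}"
proof -
  let ?Z = "{x \<in> nonzero_vectors m. \<forall>F\<in>\<F>. eval_mpoly x F = 0}"
  have Union: "\<Union>(proj_zeros m \<F>) = ?Z"
  proof (intro equalityI subsetI)
    fix x
    assume "x \<in> \<Union>(proj_zeros m \<F>)"
    then show "x \<in> ?Z"
      using in_quotient_imp_subset [OF equiv_proportional]
      by (auto simp: proj_zeros_def proj_space_def)
  next
    fix x
    assume x: "x \<in> ?Z"
    then have "proportional m `` {x} \<in> proj_space m"
      by (simp add: proj_space_def quotientI)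
    then have "proportional m `` {x} \<in> proj_zeros m \<F>"
      using x assms by (auto simp: proj_zeros_def proportional_def eval_mpoly_scaled subset_iff)
    moreover have "x \<in> proportional m `` {x}"
      using x equiv_class_self [OF equiv_proportional] by blast
    ultimately show "x \<in> \<Union>(proj_zeros m \<F>)"
      by blast
  qed
  have "(CARD('a) - 1) * card (proj_zeros m \<F>) = card (\<Union>(proj_zeros m \<F>))"
  proof (rule card_partition)
    show "finite (proj_zeros m \<F>)"
      by (simp add: proj_zeros_def finite_proj_space)
    show "finite (\<Union>(proj_zeros m \<F>))"
      unfolding Union by (simp add: finite_nonzero_vectors)
    show "card P = CARD('a) - 1" if "P \<in> proj_zeros m \<F>" for P
      using that by (auto simp: proj_zeros_def proj_space_def card_proportional_class elim!: quotientE)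
    show "P \<inter> Q = {}" if "P \<in> proj_zeros m \<F>" "Q \<in> proj_zeros m \<F>" "P \<noteq> Q" for P Q
      using that quotient_disj [OF equiv_proportional] by (auto simp: proj_zeros_def proj_space_def)
  qed
  with Union show ?thesis
    by simp
qed

text \<open>The summand 1 counts the zero vector, which is a common zero because the degree is
  positive. Bounding the projective zeros from above thus means bounding the nonzeros from
  below.\<close>

lemma card_proj_zeros_plus_nonzeros:
  fixes \<F> :: "'a::{field,finite} mpoly set"
  assumes "\<F> \<subseteq> homogeneous_polys m d" "d > 0"
  shows "(CARD('a) - 1) * card (proj_zeros m \<F>) +
           card {x \<in> supported_on {..m}. \<exists>F\<in>\<F>. eval_mpoly x F \<noteq> 0} + 1 = CARD('a) ^ (m + 1)"
proof -
  let ?Z = "{x \<in> nonzero_vectors m. \<forall>F\<in>\<F>. eval_mpoly x F = 0}"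
  let ?W = "{x \<in> supported_on {..m}. \<exists>F\<in>\<F>. eval_mpoly x F \<noteq> 0}"
  have nz: "nonzero_vectors m = supported_on {..m} - {\<lambda>_. 0 :: 'a}"
    by (auto simp: nonzero_vectors_def supported_on_def fun_eq_iff not_le)
       (metis not_le)
  have "eval_mpoly (\<lambda>_. 0) F = 0" if "F \<in> \<F>" for F
    using that assms eval_mpoly_scaled [of F m d 0 "\<lambda>_. 0"] by (auto simp: zero_power)
  then have split: "supported_on {..m} = insert (\<lambda>_. 0) (?Z \<union> ?W)"
    and notin: "(\<lambda>_. 0) \<notin> ?Z \<union> ?W"
    unfolding nz by (auto simp: supported_on_def)
  have fin: "finite ?Z" "finite ?W" and disj: "?Z \<inter> ?W = {}"
    by (auto simp: finite_nonzero_vectors)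
  have "card (supported_on {..m} :: (nat \<Rightarrow> 'a) set) = card (insert (\<lambda>_. 0) (?Z \<union> ?W))"
    by (rule arg_cong [OF split])
  also have "\<dots> = card ?Z + card ?W + 1"
    by (simp only: card_insert_disjoint [OF finite_UnI [OF fin] notin] card_Un_disjoint [OF fin disj]
        Suc_eq_plus1)
  finally show ?thesis
    using card_proj_zeros [OF assms(1)] by (simp add: card_supported_on)
qed

lemma proj_count_eq:
  assumes "q > 0" "r \<le> m"
  shows "(q - 1) * proj_count q (int m - int r - 1) + 1 = q ^ (m - r)"
proof -
  have geom: "(q - 1) * (\<Sum>i<n. q ^ i) + 1 = q ^ n" for n
    using assms(1)
  proof (induction n)
    case (Suc n)
    then show ?case
      by (cases q) (auto simp: algebra_simps)
  qed simp
  have "proj_count q (int m - int r - 1) = (\<Sum>i<m - r. q ^ i)"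
  \<comment> \<open>For m = r the argument of \<open>proj_count\<close> is -1 and its value 0,
    matching the empty geometric sum.\<close>
  proof (cases "m = r")
    case False
    then have "{..nat (int m - int r - 1)} = {..<m - r}"
      using assms by auto
    then show ?thesis
      using False assms by (simp add: proj_count_def)
  qed (simp add: proj_count_def)
  with geom show ?thesis
    by simp
qed

section \<open>The extremal family\<close>

text \<open>$X_i^q - X_i X_0^{q-1}$\<close>

definition frobenius_form :: "nat \<Rightarrow> 'a::{field,finite} mpoly" where
  "frobenius_form i = Poly_Mapping.single (Poly_Mapping.single i CARD('a)) 1 -
     Poly_Mapping.single (Poly_Mapping.single i 1 + Poly_Mapping.single 0 (CARD('a) - 1)) 1"

lemma keys_single_plus_single:
  assumes "i \<noteq> 0" "n > 0"
  shows "Poly_Mapping.keys (Poly_Mapping.single i 1 + Poly_Mapping.single 0 n :: nat \<Rightarrow>\<^sub>0 nat) = {0, i}"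
  using assms by (auto simp: in_keys_iff lookup_add lookup_single when_def split: if_splits)

text \<open>The exponents of X_0 differ: q - 1 > 0 on the left and 0 on the right.\<close>

lemma frobenius_exponents_neq:
  assumes "i \<noteq> 0" "j \<noteq> 0"
  shows "Poly_Mapping.single i 1 + Poly_Mapping.single 0 (CARD('a::{field,finite}) - 1) \<noteq>
           Poly_Mapping.single j CARD('a)"
proof
  assume eq: "Poly_Mapping.single i 1 + Poly_Mapping.single 0 (CARD('a) - 1) =
    Poly_Mapping.single j CARD('a)"
  from arg_cong [OF eq, of "\<lambda>p. Poly_Mapping.lookup p 0"] show False
    using assms CARD_field_gt_1 [where 'a = 'a] by (simp add: lookup_add lookup_single)
qed

lemma frobenius_form_homogeneous:
  assumes "i \<noteq> 0" "i \<le> m"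
  shows "(frobenius_form i :: 'a::{field,finite} mpoly) \<in> homogeneous_polys m CARD('a)"
proof -
  have q: "CARD('a) > 1"
    by (rule CARD_field_gt_1)
  have "Poly_Mapping.keys (frobenius_form i :: 'a mpoly) \<subseteq>
      {Poly_Mapping.single i CARD('a), Poly_Mapping.single i 1 + Poly_Mapping.single 0 (CARD('a) - 1)}"
    unfolding frobenius_form_def by (rule order_trans [OF keys_diff]) simp
  moreover have "mono_degree (Poly_Mapping.single i 1 + Poly_Mapping.single 0 (CARD('a) - 1)) = CARD('a)"
    using assms q keys_single_plus_single [of i "CARD('a) - 1"]
    by (simp add: mono_degree_def lookup_add lookup_single)
  moreover have "mono_degree (Poly_Mapping.single i CARD('a)) = CARD('a)"
    by (simp add: mono_degree_def)
  moreover have "Poly_Mapping.keys (Poly_Mapping.single i 1 + Poly_Mapping.single 0 (CARD('a) - 1))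
      \<subseteq> {..m}" "Poly_Mapping.keys (Poly_Mapping.single i CARD('a)) \<subseteq> {..m}"
    using assms q keys_single_plus_single [of i "CARD('a) - 1"] by simp_all
  ultimately show ?thesis
    unfolding homogeneous_polys_def by blast
qed

lemma eval_frobenius_form:
  fixes x :: "nat \<Rightarrow> 'a::{field,finite}"
  assumes "i \<noteq> 0"
  shows "eval_mpoly x (frobenius_form i) = x i * (1 - x 0 ^ (CARD('a) - 1))"
proof -
  let ?\<mu> = "Poly_Mapping.single i CARD('a)"
  let ?\<nu> = "Poly_Mapping.single i 1 + Poly_Mapping.single 0 (CARD('a) - 1)"
  have q: "CARD('a) > 1"
    by (rule CARD_field_gt_1)
  have neq: "?\<nu> \<noteq> ?\<mu>"
    using frobenius_exponents_neq assms by blast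
  have "Poly_Mapping.keys (frobenius_form i :: 'a mpoly) \<subseteq> {?\<mu>, ?\<nu>}"
    unfolding frobenius_form_def by (rule order_trans [OF keys_diff]) simp
  from eval_mpoly_superset [OF _ this, of x]
  have "eval_mpoly x (frobenius_form i) = x i ^ CARD('a) - x i * x 0 ^ (CARD('a) - 1)"
    using neq q assms keys_single_plus_single [of i "CARD('a) - 1"]
    by (simp add: frobenius_form_def lookup_minus lookup_single lookup_add)
  then show ?thesis
    by (simp add: power_card_eq right_diff_distrib)
qed

text \<open>The factor 1 - x_0^{q-1} is 0 for x_0 \<noteq> 0 and 1 for x_0 = 0. All these forms
  therefore vanish on the whole affine chart x_0 \<noteq> 0.\<close>

lemma eval_frobenius_form_eq_0_iff:
  fixes x :: "nat \<Rightarrow> 'a::{field,finite}"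
  assumes "i \<noteq> 0"
  shows "eval_mpoly x (frobenius_form i) = 0 \<longleftrightarrow> x i = 0 \<or> x 0 \<noteq> 0"
proof (cases "x 0 = 0")
  case True
  then show ?thesis
    using CARD_field_gt_1 [where 'a = 'a] by (simp add: eval_frobenius_form assms zero_power)
next
  case False
  then show ?thesis
    by (simp only: eval_frobenius_form assms power_card_eq_1 not_False_eq_True) simp
qed

text \<open>The coefficients at the pure powers X_j^q act as a dual family, which gives both
  injectivity and independence.\<close>

lemma lookup_frobenius_form:
  assumes "i \<noteq> 0" "j \<noteq> 0"
  shows "Poly_Mapping.lookup (frobenius_form i :: 'a::{field,finite} mpoly)
           (Poly_Mapping.single j CARD('a)) = (if i = j then 1 else 0)"
proof -
  have "Poly_Mapping.single i CARD('a) = Poly_Mapping.single j CARD('a) \<longleftrightarrow> i = j"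
    by (metis lookup_single_eq lookup_single_not_eq zero_less_card_finite less_irrefl)
  then show ?thesis
    using frobenius_exponents_neq [OF assms, where 'a = 'a]
    by (simp add: frobenius_form_def lookup_minus lookup_single when_def)
qed

lemma inj_on_frobenius_form:
  assumes "0 \<notin> I"
  shows "inj_on (frobenius_form :: nat \<Rightarrow> 'a::{field,finite} mpoly) I"
proof (rule inj_onI)
  fix i j
  assume "i \<in> I" "j \<in> I" "(frobenius_form i :: 'a mpoly) = frobenius_form j"
  then show "i = j"
    using lookup_frobenius_form [of i j, where 'a = 'a] lookup_frobenius_form [of j j, where 'a = 'a] assms
    by (metis zero_neq_one)
qed

lemma independent_frobenius_form:
  assumes "0 \<notin> I"
  shows "mpoly.independent (frobenius_form ` I :: 'a::{field,finite} mpoly set)"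
  unfolding mpoly.independent_explicit_module
proof (intro allI impI)
  fix T :: "'a mpoly set" and u G
  assume T: "finite T" "T \<subseteq> frobenius_form ` I" "(\<Sum>F\<in>T. scale_mpoly (u F) F) = 0" "G \<in> T"
  then obtain j where j: "j \<in> I" "G = frobenius_form j"
    by blast
  have coeff: "Poly_Mapping.lookup F (Poly_Mapping.single j CARD('a)) = (if F = G then 1 else 0)"
    if F: "F \<in> T" for F
  proof -
    obtain i where i: "i \<in> I" "F = frobenius_form i"
      using F T(2) by blast
    then show ?thesis
      using lookup_frobenius_form [of i j] j assms inj_onD [OF inj_on_frobenius_form [OF assms], of i j]
      by (metis (full_types))
  qed
  \<comment> \<open>Reading off the coefficient of X_j^q isolates \<open>u G\<close>.\<close>
  have "0 = (\<Sum>F\<in>T. u F * Poly_Mapping.lookup F (Poly_Mapping.single j CARD('a)))"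
    using arg_cong [OF T(3), of "\<lambda>p. Poly_Mapping.lookup p (Poly_Mapping.single j CARD('a))"]
    by (simp add: lookup_sum lookup_scale_mpoly)
  also have "\<dots> = (\<Sum>F\<in>T. if F = G then u F else 0)"
    by (rule sum.cong) (auto simp: coeff)
  also have "\<dots> = u G"
    using T by simp
  finally show "u G = 0"
    by simp
qed

text \<open>A vector is not a common zero exactly when x_0 = 0 and some x_i with 1 \<le> i \<le> r
  is nonzero: it is supported on \<open>{1..m}\<close> but not on \<open>{r + 1..m}\<close>.\<close>

lemma card_common_nonzeros_frobenius_form:
  assumes "r \<le> m"
  shows "card {x \<in> supported_on {..m}. \<exists>F\<in>frobenius_form ` {1..r}. eval_mpoly x F \<noteq> (0 :: 'a::{field,finite})}
           = CARD('a) ^ m - CARD('a) ^ (m - r)"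
proof -
  have "{x \<in> supported_on {..m}. \<exists>F\<in>frobenius_form ` {1..r}. eval_mpoly x F \<noteq> (0 :: 'a)} =
      supported_on {1..m} - supported_on {r + 1..m}"
  proof (intro equalityI subsetI)
    fix x :: "nat \<Rightarrow> 'a"
    assume "x \<in> {x \<in> supported_on {..m}. \<exists>F\<in>frobenius_form ` {1..r}. eval_mpoly x F \<noteq> (0 :: 'a)}"
    then obtain i where x: "x \<in> supported_on {..m}" "x 0 = 0" and i: "i \<in> {1..r}" "x i \<noteq> 0"
      by (auto simp: eval_frobenius_form_eq_0_iff)
    have "x j = 0" if "j \<notin> {1..m}" for j
      using x that by (cases "j = 0") (auto simp: supported_on_def)
    moreover have "x \<notin> supported_on {r + 1..m}"
      using i by (force simp: supported_on_def)
    ultimately show "x \<in> supported_on {1..m} - supported_on {r + 1..m}"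
      by (simp add: supported_on_def)
  next
    fix x :: "nat \<Rightarrow> 'a"
    assume x: "x \<in> supported_on {1..m} - supported_on {r + 1..m}"
    then obtain i where i: "x i \<noteq> 0" "i \<notin> {r + 1..m}"
      by (auto simp: supported_on_def)
    have "i \<in> {1..m}"
      using x i(1) unfolding supported_on_def by blast
    moreover have "x 0 = 0"
      using x by (simp add: supported_on_def)
    ultimately have "i \<in> {1..r}" "eval_mpoly x (frobenius_form i) \<noteq> 0"
      using i by (auto simp: eval_frobenius_form_eq_0_iff)
    moreover have "x \<in> supported_on {..m}"
      using x by (auto simp: supported_on_def)
    ultimately show "x \<in> {x \<in> supported_on {..m}. \<exists>F\<in>frobenius_form ` {1..r}. eval_mpoly x F \<noteq> (0 :: 'a)}"
      by blast
  qed
  moreover have "supported_on {r + 1..m} \<subseteq> (supported_on {1..m} :: (nat \<Rightarrow> 'a) set)"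
    by (auto simp: supported_on_def)
  ultimately show ?thesis
    by (simp add: card_Diff_subset card_supported_on)
qed

section \<open>The maximal number of zeros\<close>

theorem theorem6p2:
  fixes q m r :: nat
  assumes "CARD('a::{field,finite}) = q"
    and "q \<ge> 3"
    and "1 \<le> r" and "r \<le> m"
  shows "max_zeros TYPE('a) r q m = q ^ m + proj_count q (int m - int r - 1)"
proof -
  define e where "e = q ^ m + proj_count q (int m - int r - 1)"
  have le: "q ^ (m - r) \<le> q ^ m"
    using assms by (intro power_increasing) auto
  \<comment> \<open>So \<open>e\<close> is the number of projective zeros that corresponds to
    exactly q^m - q^{m-r} nonzero vectors, the least possible number.\<close>
  have e: "(q - 1) * e + (q ^ m - q ^ (m - r)) + 1 = q ^ (m + 1)"
  proof -
    have "(q - 1) * e + 1 = (q - 1) * q ^ m + q ^ (m - r)"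
      using proj_count_eq [of q r m] assms by (simp add: e_def distrib_left)
    moreover have "(q - 1) * q ^ m + q ^ m = q ^ (m + 1)"
      using assms by (cases q) simp_all
    ultimately show ?thesis
      using le by linarith
  qed
  have "max_zeros TYPE('a) r q m = e"
    unfolding max_zeros_def
  proof (rule Max_eqI [OF finite_zero_counts])
    fix n
    assume "n \<in> zero_counts TYPE('a) r q m"
    then obtain \<F> :: "'a mpoly set" where n: "n = card (proj_zeros m \<F>)"
      and \<F>: "finite \<F>" "card \<F> = r" "\<F> \<subseteq> homogeneous_polys m q" "mpoly.independent \<F>"
      by (auto simp: zero_counts_def)
    define w where "w = card {x \<in> supported_on {..m}. \<exists>F\<in>\<F>. eval_mpoly x F \<noteq> 0}"
    have "q ^ m - q ^ (m - r) \<le> w"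
      using card_common_nonzeros_ge [of \<F> r m] \<F> assms by (simp add: w_def)
    moreover have "(q - 1) * n + w + 1 = q ^ (m + 1)"
      using card_proj_zeros_plus_nonzeros [OF \<F>(3)] assms by (simp add: n w_def)
    ultimately have "(q - 1) * n \<le> (q - 1) * e"
      using e by linarith
    then show "n \<le> e"
      using assms by simp
  \<comment> \<open>The forms \<open>frobenius_form i\<close> with 1 \<le> i \<le> r have exactly
    this least number of nonzeros, so the maximum is attained.\<close>
  next
    let ?\<F> = "frobenius_form ` {1..r} :: 'a mpoly set"
    have hom: "?\<F> \<subseteq> homogeneous_polys m q"
      using frobenius_form_homogeneous [where 'a = 'a] assms by auto
    have "(q - 1) * card (proj_zeros m ?\<F>) + (q ^ m - q ^ (m - r)) + 1 = q ^ (m + 1)"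
      using card_proj_zeros_plus_nonzeros [OF hom]
        card_common_nonzeros_frobenius_form [of r m, where 'a = 'a] assms by simp
    then have "(q - 1) * card (proj_zeros m ?\<F>) = (q - 1) * e"
      using e by linarith
    then have "card (proj_zeros m ?\<F>) = e"
      using assms by simp
    moreover have "card ?\<F> = r"
      by (simp add: card_image inj_on_frobenius_form)
    moreover have "mpoly.independent ?\<F>"
      by (rule independent_frobenius_form) simp
    ultimately show "e \<in> zero_counts TYPE('a) r q m"
      using hom unfolding zero_counts_def by blast
  qed
  then show ?thesis
    by (simp add: e_def)
qed

end
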